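(* Let $\mathcal{C}(R^{\infty})$ be the vector space of all continuous real-valued functions on $R^{\infty}$. The Dirac delta functional $\delta:\mathcal{C}(R^{\infty})\to R$, $\delta(f)=\lim_{\epsilon\to 0+}\int_{R^{\infty}}\eta_{\epsilon}(x)f(x)\,d\lambda(x)$, is a linear functional such that $\delta(f)=f(\mathbf{0})$ for each $f\in\mathcal{C}(R^{\infty})$, where $\mathbf{0}$ denotes the zero of $R^{\infty}$.
   Context: $R$ denotes the real line. $R^{\infty}=\prod_{k=1}^{\infty}R$ is the space of all real sequences with the Tychonoff (product) topology. $\lambda$ denotes a Baker measure on $R^{\infty}$: the completion of a translation-invariant Borel measure on $R^{\infty}$ such that $\lambda\big(\prod_{i=1}^{\infty}(a_i,b_i)\big)=\prod_{i=1}^{\infty}(b_i-a_i):=\lim_{n\to\infty}\prod_{i=1}^{n}(b_i-a_i)$ whenever $-\infty<a_i<b_i<+\infty$ for all $i$ and $0\le\prod_{i=1}^{\infty}(b_i-a_i)<+\infty$. For $\epsilon>0$ put $a_k(\epsilon)=\frac12 e^{-\frac{1}{2^k\epsilon}}$ for $k\ge 1$, and $\Delta_{\epsilon}=\prod_{k=1}^{\infty}[-a_k(\epsilon),a_k(\epsilon)]$. Its measure is $\lambda(\Delta_{\epsilon})=\prod_{k=1}^{\infty}2a_k(\epsilon)=e^{-\sum_{k=1}^{\infty}\frac{1}{2^k\epsilon}}$. Define $\eta_{\epsilon}:R^{\infty}\to R$ by $\eta_{\epsilon}(x)=e^{\sum_{k=1}^{\infty}\frac{1}{2^k\epsilon}}$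 if $x\in\Delta_{\epsilon}$ and $\eta_{\epsilon}(x)=0$ otherwise. The limit defining $\delta(f)$ is called the Dirac delta integral and is denoted $(\delta)\int_{R^{\infty}}\delta(x)f(x)\,d\lambda(x)$. *)

theory Defs
  imports "HOL-Analysis.Analysis"
begin

text \<open>
  \<open>R\<^sup>\<infinity>\<close> is the type \<^typ>\<open>nat \<Rightarrow> real\<close>, whose library topology is the product topology.
  Coordinates are numbered from 0, so coordinate \<open>k\<close> here is coordinate \<open>k + 1\<close> of \<open>R\<^sup>\<infinity>\<close> numbered
  from 1; this is the reason for the exponents \<open>Suc k\<close> below.
\<close>

type_synonym R_inf = "nat \<Rightarrow> real"

definition translation_invariant :: "R_inf measure \<Rightarrow> bool" where
  "translation_invariant M \<longleftrightarrow>
     (\<forall>v. \<forall>A \<in> sets M. (\<lambda>x i. x i + v i) ` A \<in> sets M \<and>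
        emeasure M ((\<lambda>x i. x i + v i) ` A) = emeasure M A)"

text \<open>
  The infinite product of side lengths is the plain limit of the partial products, so the value 0
  is allowed (unlike in \<^const>\<open>convergent_prod\<close>).
\<close>

definition Baker_measure :: "R_inf measure \<Rightarrow> bool" where
  "Baker_measure L \<longleftrightarrow>
     (\<exists>M. sets M = sets borel \<and> translation_invariant M \<and> L = completion M \<and>
        (\<forall>a b p. (\<forall>i. a i < b i) \<and> (\<lambda>n. \<Prod>i<n. b i - a i) \<longlonglongrightarrow> p \<longrightarrow>
           emeasure L (Pi UNIV (\<lambda>i. {a i<..<b i})) = ennreal p))"

definition half_side :: "real \<Rightarrow> nat \<Rightarrow> real" where
  "half_side \<epsilon> k = 1 / 2 * exp (- (1 / (2 ^ Suc k * \<epsilon>)))"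

definition Delta_box :: "real \<Rightarrow> R_inf set" where
  "Delta_box \<epsilon> = Pi UNIV (\<lambda>k. {- half_side \<epsilon> k..half_side \<epsilon> k})"

definition eta :: "real \<Rightarrow> R_inf \<Rightarrow> real" where
  "eta \<epsilon> x = (if x \<in> Delta_box \<epsilon> then exp (\<Sum>k. 1 / (2 ^ Suc k * \<epsilon>)) else 0)"

typedef cont_R_inf = "{f :: R_inf \<Rightarrow> real. continuous_on UNIV f}"
  morphisms apply_cont Abs_cont
  by (rule exI[of _ "\<lambda>_. 0"]) simp

setup_lifting type_definition_cont_R_inf

instantiation cont_R_inf :: real_vector
begin

lift_definition zero_cont_R_inf :: cont_R_inf is "\<lambda>_. 0"
  by (rule continuous_on_const)

lift_definition plus_cont_R_inf :: "cont_R_inf \<Rightarrow> cont_R_inf \<Rightarrow> cont_R_inf" is "\<lambda>f g x. f x + g x"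
  by (rule continuous_on_add)

lift_definition uminus_cont_R_inf :: "cont_R_inf \<Rightarrow> cont_R_inf" is "\<lambda>f x. - f x"
  by (rule continuous_on_minus)

lift_definition minus_cont_R_inf :: "cont_R_inf \<Rightarrow> cont_R_inf \<Rightarrow> cont_R_inf" is "\<lambda>f g x. f x - g x"
  by (rule continuous_on_diff)

lift_definition scaleR_cont_R_inf :: "real \<Rightarrow> cont_R_inf \<Rightarrow> cont_R_inf" is "\<lambda>c f x. c * f x"
  by (rule continuous_on_mult_left)

instance
  by standard (transfer; simp add: fun_eq_iff algebra_simps)+

end

text \<open>
  \<^const>\<open>Lim\<close> and the Bochner integral are total, so that the limit and the integrals exist has to
  be asserted separately wherever \<open>dirac_delta\<close> is used.
\<close>

definition dirac_delta :: "R_inf measure \<Rightarrow> cont_R_inf \<Rightarrow> real" where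
  "dirac_delta L f = Lim (at_right 0) (\<lambda>\<epsilon>. LINT x|L. eta \<epsilon> x * apply_cont f x)"

end

theory Submission imports Defs begin

text \<open>
  The box \<open>Delta_box \<epsilon>\<close> contains the open box with the same sides, and is contained in the open
  box whose \<open>k\<close>-th side is longer by the factor \<open>exp (c / 2 ^ Suc k)\<close>, for every \<open>c > 0\<close>. The
  volumes of these open boxes are \<open>exp (- 1 / \<epsilon>)\<close> and \<open>exp (c - 1 / \<epsilon>)\<close>, so \<open>eta \<epsilon>\<close> is a
  probability density. The box is compact, hence \<open>\<bar>f x - f 0\<bar>\<close> attains its maximum over it at some
  \<open>x \<epsilon>\<close>, which bounds the error of the integral. Each coordinate of \<open>x \<epsilon>\<close> tends to 0 as
  \<open>\<epsilon> \<rightarrow> 0+\<close>, so \<open>x \<epsilon>\<close> tends to 0 in the product topology and the error vanishes by continuity.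
\<close>

lemma Baker_measure_sets:
  assumes "Baker_measure L"
  shows "sets borel \<subseteq> sets L"
  using assms unfolding Baker_measure_def by (metis sets_completionI_sets subsetI)

lemma Baker_measure_open_box:
  assumes "Baker_measure L" "\<And>i. a i < b i" "(\<lambda>n. \<Prod>i<n. b i - a i) \<longlonglongrightarrow> p"
  shows "emeasure L (Pi UNIV (\<lambda>i. {a i<..<b i})) = ennreal p"
  using assms unfolding Baker_measure_def by blast

lemma Baker_measure_space:
  assumes "Baker_measure L"
  shows "space L = UNIV"
  using assms unfolding Baker_measure_def
  by (metis sets_eq_imp_space_eq space_borel space_completion)

text \<open>Borel measurability passes to the completion, which keeps the space and only adds
  measurable sets.\<close>

lemma Baker_measure_measurable:
  fixes f :: "R_inf \<Rightarrow> real"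
  assumes "Baker_measure L" "continuous_on UNIV f"
  shows "f \<in> borel_measurable L"
proof -
  have "f \<in> borel_measurable borel"
    using assms(2) by (rule borel_measurable_continuous_onI)
  then show ?thesis
    using Baker_measure_sets[OF assms(1)] Baker_measure_space[OF assms(1)]
    by (auto simp: measurable_def)
qed

lemma sums_geometric_half:
  fixes c :: real
  shows "(\<lambda>k. c / 2 ^ Suc k) sums c"
  using sums_mult[OF power_half_series, of c] by (simp add: power_divide)

lemma half_side_pos: "0 < half_side \<epsilon> k"
  by (simp add: half_side_def)

lemma half_side_tendsto_0: "((\<lambda>\<epsilon>. half_side \<epsilon> k) \<longlongrightarrow> 0) (at_right 0)"
proof -
  have "filterlim (\<lambda>\<epsilon>::real. (1 / 2 ^ Suc k) * inverse \<epsilon>) at_top (at_right 0)"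
    by (intro filterlim_tendsto_pos_mult_at_top[OF tendsto_const] filterlim_inverse_at_top_right) simp
  then have "filterlim (\<lambda>\<epsilon>::real. - (1 / (2 ^ Suc k * \<epsilon>))) at_bot (at_right 0)"
    by (subst filterlim_uminus_at_top[symmetric]) (simp add: field_simps)
  then have "((\<lambda>\<epsilon>::real. exp (- (1 / (2 ^ Suc k * \<epsilon>)))) \<longlongrightarrow> 0) (at_right 0)"
    by (rule filterlim_compose[OF exp_at_bot])
  then show ?thesis
    unfolding half_side_def by (rule tendsto_mult_right_zero)
qed

text \<open>The factor 1/2 in \<open>half_side\<close> cancels, so each side length is a pure
  exponential and the partial products are exponentials of partial sums of a geometric series. The
  double minus matches \<open>b i - a i\<close> for a symmetric interval.\<close>

lemma prod_sides_tendsto: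
  assumes "\<epsilon> > 0"
  shows "(\<lambda>n. \<Prod>k<n. half_side \<epsilon> k * exp (c / 2 ^ Suc k) - - (half_side \<epsilon> k * exp (c / 2 ^ Suc k)))
    \<longlonglongrightarrow> exp (c - 1 / \<epsilon>)"
proof -
  have "half_side \<epsilon> k * exp (c / 2 ^ Suc k) - - (half_side \<epsilon> k * exp (c / 2 ^ Suc k))
      = exp ((c - 1 / \<epsilon>) / 2 ^ Suc k)" for k
    by (simp add: half_side_def exp_add[symmetric] diff_divide_distrib mult.commute)
  then show ?thesis
    using tendsto_exp[OF sums_geometric_half[of "c - 1 / \<epsilon>", unfolded sums_def]]
    by (simp add: exp_sum)
qed

lemma emeasure_scaled_box:
  assumes "Baker_measure L" "\<epsilon> > 0"
  shows "emeasure L (Pi UNIV (\<lambda>k. {- (half_side \<epsilon> k * exp (c / 2 ^ Suc k))<..<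
    half_side \<epsilon> k * exp (c / 2 ^ Suc k)})) = ennreal (exp (c - 1 / \<epsilon>))"
proof (rule Baker_measure_open_box[OF assms(1) _ prod_sides_tendsto[OF assms(2)]])
  show "- (half_side \<epsilon> k * exp (c / 2 ^ Suc k)) < half_side \<epsilon> k * exp (c / 2 ^ Suc k)" for k
    using half_side_pos[of \<epsilon> k] by (smt (verit) exp_gt_zero mult_pos_pos)
qed

text \<open>A box restricting infinitely many coordinates need not be open in the product topology,
  so it is written as a countable intersection of coordinate conditions.\<close>

lemma open_box_in_borel: "Pi UNIV (\<lambda>k::nat. {a k<..<b k :: real}) \<in> sets borel"
proof -
  have "Pi UNIV (\<lambda>k. {a k<..<b k}) = (\<Inter>k. {x. a k < x k} \<inter> {x. x k < b k})"
    by auto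
  moreover have "(\<lambda>x::R_inf. x k) \<in> borel_measurable borel" for k
    by (intro borel_measurable_continuous_onI continuous_on_product_coordinates)
  ultimately show ?thesis
    by simp
qed

text \<open>Tychonoff's theorem. Compactness later gives measurability of the box (it is closed),
  boundedness of continuous functions on it, and attained maxima.\<close>

lemma compact_Delta_box: "compact (Delta_box \<epsilon>)"
  using compactin_PiE[of "\<lambda>_. euclidean" UNIV "\<lambda>k. {- half_side \<epsilon> k..half_side \<epsilon> k}"]
  by (simp add: Delta_box_def euclidean_product_topology PiE_UNIV_domain)

lemma zero_in_Delta_box: "(\<lambda>_. 0) \<in> Delta_box \<epsilon>"
  by (simp add: Delta_box_def less_imp_le[OF half_side_pos])

lemma Delta_box_in_sets:
  assumes "Baker_measure L"
  shows "Delta_box \<epsilon> \<in> sets L"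
  using Baker_measure_sets[OF assms] borel_closed[OF compact_imp_closed[OF compact_Delta_box]]
  by (rule subsetD)

lemma emeasure_Delta_box:
  assumes L: "Baker_measure L" and \<epsilon>: "\<epsilon> > 0"
  shows "emeasure L (Delta_box \<epsilon>) = ennreal (exp (- (1 / \<epsilon>)))"
proof (rule antisym)
  \<comment> \<open>The scale \<open>c = 0\<close> is left unsimplified so that
    \<open>emeasure_scaled_box\<close> rewrites the volume directly.\<close>
  have "emeasure L (Pi UNIV (\<lambda>k. {- (half_side \<epsilon> k * exp (0 / 2 ^ Suc k))<..<
      half_side \<epsilon> k * exp (0 / 2 ^ Suc k)})) \<le> emeasure L (Delta_box \<epsilon>)"
    by (intro emeasure_mono Delta_box_in_sets L) (fastforce simp: Delta_box_def Pi_iff intro: less_imp_le)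
  then show "ennreal (exp (- (1 / \<epsilon>))) \<le> emeasure L (Delta_box \<epsilon>)"
    unfolding emeasure_scaled_box[OF L \<epsilon>] by simp
next
  have upper: "emeasure L (Delta_box \<epsilon>) \<le> ennreal (exp (c - 1 / \<epsilon>))" if "c > 0" for c
  proof -
    have "half_side \<epsilon> k < half_side \<epsilon> k * exp (c / 2 ^ Suc k)" for k
      using half_side_pos[of \<epsilon> k] that by simp
    then have "Delta_box \<epsilon> \<subseteq> Pi UNIV (\<lambda>k. {- (half_side \<epsilon> k * exp (c / 2 ^ Suc k))<..<
        half_side \<epsilon> k * exp (c / 2 ^ Suc k)})"
      unfolding Delta_box_def by (intro Pi_mono) (smt (verit) atLeastAtMost_iff greaterThanLessThan_iff subsetI)
    then show ?thesis
      unfolding emeasure_scaled_box[OF L \<epsilon>, symmetric]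
      using open_box_in_borel Baker_measure_sets[OF L] by (intro emeasure_mono) auto
  qed
  \<comment> \<open>Letting \<open>c\<close> decrease to 0 closes the gap between the outer volumes
    and the inner one.\<close>
  have "((\<lambda>c. ennreal (exp (c - 1 / \<epsilon>))) \<longlongrightarrow> ennreal (exp (0 - 1 / \<epsilon>))) (at_right 0)"
    by (intro tendsto_ennrealI tendsto_intros)
  then have "((\<lambda>c. ennreal (exp (c - 1 / \<epsilon>))) \<longlongrightarrow> ennreal (exp (- (1 / \<epsilon>)))) (at_right 0)"
    by simp
  moreover have "\<forall>\<^sub>F c in at_right 0. emeasure L (Delta_box \<epsilon>) \<le> ennreal (exp (c - 1 / \<epsilon>))"
    using upper by (auto intro: eventually_mono[OF eventually_at_right_less])
  ultimately show "emeasure L (Delta_box \<epsilon>) \<le> ennreal (exp (- (1 / \<epsilon>)))"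
    by (rule tendsto_lowerbound) simp
qed

text \<open>Summing the geometric series gives the height of the density as the reciprocal of the
  volume of the box when \<epsilon> is positive. At \<epsilon> = 0 both exponents are 0 by the
  convention for division.\<close>

lemma eta_eq_indicator: "eta \<epsilon> x = exp (1 / \<epsilon>) * indicator (Delta_box \<epsilon>) x"
proof -
  have "(\<lambda>k. 1 / (2 ^ Suc k * \<epsilon>)) sums (1 / \<epsilon>)"
    using sums_geometric_half[of "1 / \<epsilon>"] by (simp add: mult.commute)
  then show ?thesis
    by (simp add: eta_def sums_unique[symmetric] indicator_def)
qed

text \<open>The integrand lives on a compact set of finite measure, where the continuous
  \<open>f\<close> is bounded.\<close>

lemma integrable_eta_mult:
  fixes f :: "R_inf \<Rightarrow> real"
  assumes L: "Baker_measure L" and \<epsilon>: "\<epsilon> > 0" and f: "continuous_on UNIV f"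
  shows "integrable L (\<lambda>x. eta \<epsilon> x * f x)"
proof -
  have "compact (f ` Delta_box \<epsilon>)"
    using f compact_Delta_box by (blast intro: compact_continuous_image continuous_on_subset)
  then obtain B where B: "\<And>x. x \<in> Delta_box \<epsilon> \<Longrightarrow> norm (f x) \<le> B"
    by (meson bounded_iff compact_imp_bounded imageI)
  have "integrable L (\<lambda>x. indicator (Delta_box \<epsilon>) x *\<^sub>R f x)"
    using B L \<epsilon> f
    by (intro integrableI_bounded_set_indicator[where B=B] Delta_box_in_sets Baker_measure_measurable)
      (auto simp: emeasure_Delta_box)
  then show ?thesis
    unfolding eta_eq_indicator by (simp add: mult.assoc)
qed

lemma integral_eta:
  assumes L: "Baker_measure L" and \<epsilon>: "\<epsilon> > 0"
  shows "(LINT x|L. eta \<epsilon> x) = 1"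
proof -
  have "measure L (Delta_box \<epsilon>) = exp (- (1 / \<epsilon>))"
    by (simp add: measure_def emeasure_Delta_box[OF assms])
  then show ?thesis
    using Baker_measure_space[OF L] by (simp add: eta_eq_indicator[abs_def] exp_add[symmetric])
qed

lemma abs_integral_eta_diff_le:
  fixes f :: "R_inf \<Rightarrow> real"
  assumes L: "Baker_measure L" and \<epsilon>: "\<epsilon> > 0" and f: "continuous_on UNIV f"
    and B: "\<And>x. x \<in> Delta_box \<epsilon> \<Longrightarrow> \<bar>f x - a\<bar> \<le> B"
  shows "\<bar>(LINT x|L. eta \<epsilon> x * f x) - a\<bar> \<le> B"
proof -
  have const: "integrable L (\<lambda>x. eta \<epsilon> x * b)" "(LINT x|L. eta \<epsilon> x * b) = b" for b
    using integrable_eta_mult[OF L \<epsilon>, of "\<lambda>_. b"] integral_eta[OF L \<epsilon>] by simp_all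
  have f_int: "integrable L (\<lambda>x. eta \<epsilon> x * f x)"
    by (rule integrable_eta_mult[OF L \<epsilon> f])
  \<comment> \<open>As \<open>eta\<close> has total mass 1, the constant \<open>a\<close> is itself
    an integral against it; the same fact turns the final integral back into
    \<open>B\<close>.\<close>
  have "(LINT x|L. eta \<epsilon> x * f x) - a = (LINT x|L. eta \<epsilon> x * f x) - (LINT x|L. eta \<epsilon> x * a)"
    by (simp only: const)
  also have "\<dots> = (LINT x|L. eta \<epsilon> x * f x - eta \<epsilon> x * a)"
    by (rule Bochner_Integration.integral_diff[OF f_int const(1), symmetric])
  also have "\<bar>\<dots>\<bar> \<le> (LINT x|L. \<bar>eta \<epsilon> x * f x - eta \<epsilon> x * a\<bar>)"
    by (rule integral_abs_bound)
  also have "\<dots> \<le> (LINT x|L. eta \<epsilon> x * B)"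
  proof (rule integral_mono)
    show "integrable L (\<lambda>x. \<bar>eta \<epsilon> x * f x - eta \<epsilon> x * a\<bar>)"
      by (intro integrable_abs Bochner_Integration.integrable_diff f_int const)
    \<comment> \<open>Off the box both sides are 0; on it the positive height factors out.\<close>
    show "\<bar>eta \<epsilon> x * f x - eta \<epsilon> x * a\<bar> \<le> eta \<epsilon> x * B" for x
      using B[of x]
      by (cases "x \<in> Delta_box \<epsilon>") (auto simp: eta_eq_indicator abs_mult simp flip: right_diff_distrib)
  qed (rule const)
  finally show ?thesis
    by (simp only: const)
qed

text \<open>Convergence in the product topology is coordinatewise, so it suffices to squeeze each
  coordinate by its own \<open>half_side\<close>, with no uniformity in \<open>k\<close>.\<close>

lemma tendsto_selection_Delta_box:
  assumes x: "\<And>\<epsilon>. x \<epsilon> \<in> Delta_box \<epsilon>"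
  shows "(x \<longlongrightarrow> (\<lambda>_. 0)) (at_right 0)"
proof -
  have "((\<lambda>\<epsilon>. x \<epsilon> k) \<longlongrightarrow> 0) (at_right 0)" for k
  proof (rule tendsto_rabs_zero_cancel, rule tendsto_sandwich[OF _ _ tendsto_const half_side_tendsto_0])
    have "\<bar>x \<epsilon> k\<bar> \<le> half_side \<epsilon> k" for \<epsilon>
      using x[of \<epsilon>] by (auto simp: Delta_box_def Pi_iff abs_le_iff minus_le_iff)
    then show "\<forall>\<^sub>F \<epsilon> in at_right 0. \<bar>x \<epsilon> k\<bar> \<le> half_side \<epsilon> k"
      by simp
  qed simp
  then have "limitin (product_topology (\<lambda>_. euclidean) UNIV) x (\<lambda>_. 0) (at_right 0)"
    by (simp add: limitin_componentwise)
  then show ?thesis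
    by (simp add: euclidean_product_topology)
qed

lemma integral_eta_tendsto:
  fixes f :: "R_inf \<Rightarrow> real"
  assumes L: "Baker_measure L" and f: "continuous_on UNIV f"
  shows "((\<lambda>\<epsilon>. LINT x|L. eta \<epsilon> x * f x) \<longlongrightarrow> f (\<lambda>_. 0)) (at_right 0)"
proof -
  \<comment> \<open>The box is compact and contains 0 for every real \<epsilon>, even a nonpositive
    one, so the maximisers form a total function \<open>y\<close>.\<close>
  have "\<exists>y\<in>Delta_box \<epsilon>. \<forall>x\<in>Delta_box \<epsilon>. \<bar>f x - f (\<lambda>_. 0)\<bar> \<le> \<bar>f y - f (\<lambda>_. 0)\<bar>" for \<epsilon>
    using zero_in_Delta_box
    by (intro continuous_attains_sup compact_Delta_box continuous_intros continuous_on_subset[OF f]) auto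
  then obtain y where y: "\<And>\<epsilon>. y \<epsilon> \<in> Delta_box \<epsilon>"
    and y_max: "\<And>\<epsilon> x. x \<in> Delta_box \<epsilon> \<Longrightarrow> \<bar>f x - f (\<lambda>_. 0)\<bar> \<le> \<bar>f (y \<epsilon>) - f (\<lambda>_. 0)\<bar>"
    by metis
  have "((\<lambda>\<epsilon>. f (y \<epsilon>)) \<longlongrightarrow> f (\<lambda>_. 0)) (at_right 0)"
    using f by (intro continuous_on_tendsto_compose[OF f tendsto_selection_Delta_box[OF y]]) auto
  then have bound: "((\<lambda>\<epsilon>. \<bar>f (y \<epsilon>) - f (\<lambda>_. 0)\<bar>) \<longlongrightarrow> 0) (at_right 0)"
    by (intro tendsto_rabs_zero) (simp add: LIM_zero)
  have "((\<lambda>\<epsilon>. (LINT x|L. eta \<epsilon> x * f x) - f (\<lambda>_. 0)) \<longlongrightarrow> 0) (at_right 0)"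
  proof (rule Lim_null_comparison[OF _ bound])
    have "\<bar>(LINT x|L. eta \<epsilon> x * f x) - f (\<lambda>_. 0)\<bar> \<le> \<bar>f (y \<epsilon>) - f (\<lambda>_. 0)\<bar>" if "\<epsilon> > 0" for \<epsilon>
      by (rule abs_integral_eta_diff_le[OF L that f y_max])
    then show "\<forall>\<^sub>F \<epsilon> in at_right 0.
        norm ((LINT x|L. eta \<epsilon> x * f x) - f (\<lambda>_. 0)) \<le> \<bar>f (y \<epsilon>) - f (\<lambda>_. 0)\<bar>"
      by (auto intro: eventually_mono[OF eventually_at_right_less])
  qed
  then show ?thesis
    by (rule LIM_zero_cancel)
qed

lemma continuous_on_apply_cont: "continuous_on UNIV (apply_cont f)"
  using apply_cont[of f] by simp

theorem theorem5p1:
  fixes \<Lambda> :: "R_inf measure"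
  assumes "Baker_measure \<Lambda>"
  shows "(\<forall>f. \<forall>\<epsilon>>0. integrable \<Lambda> (\<lambda>x. eta \<epsilon> x * apply_cont f x))
    \<and> (\<forall>f. ((\<lambda>\<epsilon>. LINT x|\<Lambda>. eta \<epsilon> x * apply_cont f x) \<longlongrightarrow> dirac_delta \<Lambda> f) (at_right 0))
    \<and> linear (dirac_delta \<Lambda>)
    \<and> (\<forall>f. dirac_delta \<Lambda> f = apply_cont f (\<lambda>_. 0))"
proof -
  have lim: "((\<lambda>\<epsilon>. LINT x|\<Lambda>. eta \<epsilon> x * apply_cont f x) \<longlongrightarrow> apply_cont f (\<lambda>_. 0)) (at_right 0)" for f
    by (rule integral_eta_tendsto[OF assms continuous_on_apply_cont])
  have val: "dirac_delta \<Lambda> f = apply_cont f (\<lambda>_. 0)" for f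
    unfolding dirac_delta_def by (rule tendsto_Lim[OF trivial_limit_at_right_real lim])
  \<comment> \<open>Linearity is inherited from evaluation at 0, since the vector space operations
    are pointwise.\<close>
  have "linear (dirac_delta \<Lambda>)"
    by (rule linearI) (simp_all add: val plus_cont_R_inf.rep_eq scaleR_cont_R_inf.rep_eq)
  then show ?thesis
    using integrable_eta_mult[OF assms _ continuous_on_apply_cont] lim by (simp add: val)
qed

end
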